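(* Let $f(X)=a_0+a_1X+\cdots+a_nX^n\in\mathbb{Z}[X]$, and assume that for two integers $a,b$ we have $0<|f(a)|<|f(b)|$ and $\gcd(f(a),f'(a))=\gcd(f(b),f'(b))=1$. Let $$q_u=\max\left\{\frac{d_2}{d_1}\le\sqrt{\frac{|f(b)|}{|f(a)|}}\;:\; d_1\in\mathcal{D}_u(f(a)),\ d_2\in\mathcal{D}_u(f(b))\right\}.$$ Then: (i) If $q_u>1$ and all the (complex) roots of $f$ lie inside the Apollonius circle $\mathrm{Ap}(a,b,q_u)$, then $f$ is irreducible over $\mathbb{Q}$. (ii) If $q_u>1$, all the roots of $f$ lie inside the Apollonius circle $\mathrm{Ap}(a,b,\sqrt{q_u})$ and $f$ has no rational roots, then $f$ is irreducible over $\mathbb{Q}$. (iii) Assume that $q_u=1$. If $b>a$ and all the roots of $f$ lie in the half-plane $\operatorname{Re} z<\frac{a+b}{2}$, or if $a>b$ and all the roots of $f$ lie in the half-plane $\operatorname{Re} z>\frac{a+b}{2}$, then $f$ is irreducible over $\mathbb{Q}$.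
   Context: Unitary divisors: for an integer $a$ with $f(a)\neq0$, an integer $d$ is a unitary divisor of $f(a)$ if $d\mid f(a)$ and $d$ is coprime with $f(a)/d$; the set of unitary divisors of $f(a)$ is denoted $\mathcal{D}_u(f(a))$. $f'$ is the derivative of $f$. Apollonius circle: for real $a\ne b$ and $k>0$, $k\neq 1$, $\mathrm{Ap}(a,b,k)$ is the set of points $z=x+iy$ of the complex plane with $|z-b|=k|z-a|$, i.e. the circle $\left(x-a+\frac{b-a}{k^2-1}\right)^2+y^2=k^2\left(\frac{b-a}{k^2-1}\right)^2$. "Inside" means in the open disk bounded by this circle; for $k>1$ this disk is $\{z\in\mathbb{C}:|z-b|>k|z-a|\}$. *)

theory Defs
  imports
    "HOL-Analysis.Analysis"
    "HOL-Computational_Algebra.Polynomial_Factorial"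
begin

definition unitary_divisors :: "int \<Rightarrow> int set" where
  "unitary_divisors m = {d. d dvd m \<and> coprime d (m div d)}"

text \<open>
  Divisors of either sign are allowed, so negative ratios occur too, but they do not affect
  the maximum: when both values of \<open>f\<close> are nonzero and \<open>\<bar>f(a)\<bar> < \<bar>f(b)\<bar>\<close>, the set
  below is finite and contains 1 (see \<open>unitary_ratios_finite\<close> and \<open>one_in_unitary_ratios\<close>),
  so \<open>Max\<close> is a genuine maximum.
\<close>

definition unitary_ratios :: "int poly \<Rightarrow> int \<Rightarrow> int \<Rightarrow> real set" where
  "unitary_ratios f a b =
    {real_of_int d2 / real_of_int d1 | d1 d2.
       d1 \<in> unitary_divisors (poly f a) \<and> d2 \<in> unitary_divisors (poly f b) \<and>
       real_of_int d2 / real_of_int d1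
         \<le> sqrt (real_of_int \<bar>poly f b\<bar> / real_of_int \<bar>poly f a\<bar>)}"

definition q\<^sub>u :: "int poly \<Rightarrow> int \<Rightarrow> int \<Rightarrow> real" where
  "q\<^sub>u f a b = Max (unitary_ratios f a b)"

text \<open>
  Meant for \<open>a \<noteq> b\<close>, \<open>k > 0\<close> and \<open>k \<noteq> 1\<close>, when it is a circle
  (see \<open>apollonius_circle_eq_sphere\<close>). The points inside it are given by
  the library's \<open>inside\<close>, i.e. the points of the bounded component of the complement,
  which is the open disk bounded by the circle (see \<open>inside_apollonius_circle\<close>).
\<close>

definition apollonius_circle :: "real \<Rightarrow> real \<Rightarrow> real \<Rightarrow> complex set" where
  "apollonius_circle a b k =
    {z. cmod (z - complex_of_real b) = k * cmod (z - complex_of_real a)}"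

lemma unitary_ratios_finite:
  assumes "poly f a \<noteq> 0" "poly f b \<noteq> 0"
  shows "finite (unitary_ratios f a b)"
proof (rule finite_subset)
  show "unitary_ratios f a b \<subseteq> (\<lambda>(d1, d2). real_of_int d2 / real_of_int d1) `
          ({d. d dvd poly f a} \<times> {d. d dvd poly f b})"
    by (auto simp: unitary_ratios_def unitary_divisors_def)
  show "finite ((\<lambda>(d1, d2). real_of_int d2 / real_of_int d1) `
          ({d. d dvd poly f a} \<times> {d. d dvd poly f b}))"
    using assms by (intro finite_imageI finite_cartesian_product finite_divisors_int) auto
qed

lemma one_in_unitary_ratios:
  assumes "0 < \<bar>poly f a\<bar>" "\<bar>poly f a\<bar> < \<bar>poly f b\<bar>"
  shows "1 \<in> unitary_ratios f a b"
proof -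
  have "1 \<le> sqrt (real_of_int \<bar>poly f b\<bar> / real_of_int \<bar>poly f a\<bar>)"
    using assms by (simp add: field_simps)
  then show ?thesis
    unfolding unitary_ratios_def unitary_divisors_def
    by (intro CollectI exI[of _ "1 :: int"]) auto
qed

lemma apollonius_identity:
  fixes a b k :: real and z :: complex
  assumes "k > 0" "k \<noteq> 1"
  defines "t \<equiv> (b - a) / (k\<^sup>2 - 1)"
  shows "(cmod (z - of_real b))\<^sup>2 - (k * cmod (z - of_real a))\<^sup>2 =
         (k\<^sup>2 - 1) * (\<bar>k * t\<bar>\<^sup>2 - (dist (complex_of_real (a - t)) z)\<^sup>2)"
proof -
  have "k\<^sup>2 \<noteq> 1" using assms by (simp add: power2_eq_1_iff)
  then have b: "b = a + t * (k\<^sup>2 - 1)" by (simp add: t_def)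
  show ?thesis
    unfolding b dist_norm power_mult_distrib cmod_power2 power2_abs
    by (simp add: power2_eq_square algebra_simps)
qed

lemma apollonius_circle_eq_sphere:
  fixes a b k :: real
  assumes "k > 0" "k \<noteq> 1"
  shows "apollonius_circle a b k =
    sphere (complex_of_real (a - (b - a) / (k\<^sup>2 - 1))) \<bar>k * ((b - a) / (k\<^sup>2 - 1))\<bar>"
proof -
  have *: "k\<^sup>2 - 1 \<noteq> 0" using assms by (simp add: power2_eq_1_iff)
  have "cmod (z - of_real b) = k * cmod (z - of_real a) \<longleftrightarrow>
      dist (complex_of_real (a - (b - a) / (k\<^sup>2 - 1))) z = \<bar>k * ((b - a) / (k\<^sup>2 - 1))\<bar>"
    (is "?l = ?r \<longleftrightarrow> ?d = ?e") for z
  proof -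
    have "?l = ?r \<longleftrightarrow> ?l\<^sup>2 - ?r\<^sup>2 = 0"
      using assms by (simp add: power2_eq_iff_nonneg)
    also have "\<dots> \<longleftrightarrow> ?e\<^sup>2 - ?d\<^sup>2 = 0"
      unfolding apollonius_identity[OF assms] using * by simp
    also have "\<dots> \<longleftrightarrow> ?e = ?d"
      unfolding right_minus_eq by (rule power2_eq_iff_nonneg) simp_all
    also have "\<dots> \<longleftrightarrow> ?d = ?e" by (rule eq_commute)
    finally show ?thesis .
  qed
  then show ?thesis
    unfolding apollonius_circle_def sphere_def by blast
qed

lemma inside_apollonius_circle:
  fixes a b k :: real
  assumes "k > 0" "k \<noteq> 1"
  shows "inside (apollonius_circle a b k) =
    ball (complex_of_real (a - (b - a) / (k\<^sup>2 - 1))) \<bar>k * ((b - a) / (k\<^sup>2 - 1))\<bar>"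
  unfolding apollonius_circle_eq_sphere[OF assms] frontier_cball[symmetric]
  by (simp only: inside_frontier_eq_interior[OF bounded_cball convex_cball] interior_cball)

lemma inside_apollonius_circle_gt_1:
  fixes a b k :: real
  assumes "k > 1"
  shows "inside (apollonius_circle a b k) =
    {z. cmod (z - complex_of_real b) > k * cmod (z - complex_of_real a)}"
proof -
  have k: "k > 0" "k \<noteq> 1" and *: "k\<^sup>2 - 1 > 0" using assms by simp_all
  have "cmod (z - of_real b) > k * cmod (z - of_real a) \<longleftrightarrow>
      dist (complex_of_real (a - (b - a) / (k\<^sup>2 - 1))) z < \<bar>k * ((b - a) / (k\<^sup>2 - 1))\<bar>"
    (is "?l > ?r \<longleftrightarrow> ?d < ?e") for z
  proof -
    have "?l > ?r \<longleftrightarrow> ?l\<^sup>2 - ?r\<^sup>2 > 0"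
      using k by (simp add: power_mono_iff flip: not_le)
    also have "\<dots> \<longleftrightarrow> ?e\<^sup>2 - ?d\<^sup>2 > 0"
      unfolding apollonius_identity[OF k] using * by (simp only: zero_less_mult_iff) auto
    also have "\<dots> \<longleftrightarrow> \<not> ?e\<^sup>2 \<le> ?d\<^sup>2" by linarith
    also have "\<dots> \<longleftrightarrow> ?d < ?e"
      by (subst power_mono_iff) (simp_all only: abs_ge_zero zero_le_dist not_le zero_less_numeral)
    finally show ?thesis .
  qed
  then show ?thesis
    unfolding inside_apollonius_circle[OF k] ball_def by blast
qed

end

theory Submission
  imports Defs "HOL-Computational_Algebra.Fundamental_Theorem_Algebra"
begin

text \<open>
  A factorization \<open>f = g h\<close> over the integers makes \<open>g(a)\<close>, \<open>h(a)\<close> unitary divisors of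
  \<open>f(a)\<close>, because a common divisor of the two would divide \<open>f'(a) = g'(a) h(a) + g(a) h'(a)\<close>;
  likewise at \<open>b\<close>. As the product of \<open>\<bar>g(b) / g(a)\<bar>\<close> and \<open>\<bar>h(b) / h(a)\<bar>\<close> is
  \<open>\<bar>f(b) / f(a)\<bar>\<close>, one of them is at most the square root of the latter, hence at most \<open>q\<^sub>u\<close>.
  But each is a product of ratios \<open>\<bar>b - z\<bar> / \<bar>a - z\<bar>\<close> over roots \<open>z\<close>, and the location
  of the roots forces this product to exceed \<open>q\<^sub>u\<close>.
\<close>

section \<open>Integer polynomials over larger rings and Gauss's lemma\<close>

lemma of_int_poly_mult:
  "map_poly (of_int :: int \<Rightarrow> 'a :: comm_ring_1) (p * q) = map_poly of_int p * map_poly of_int q"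
  by (rule poly_eqI) (simp add: coeff_map_poly coeff_mult)

lemma poly_of_int_poly:
  "poly (map_poly (of_int :: int \<Rightarrow> 'a :: comm_ring_1) p) (of_int x) = of_int (poly p x)"
  by (induction p) (simp_all add: map_poly_pCons)

lemma degree_of_int_poly:
  "degree (map_poly (of_int :: int \<Rightarrow> 'a :: ring_char_0) p) = degree p"
  by (cases "p = 0") (auto intro: map_poly_degree_eq)

lemma rat_poly_clear_denominators:
  fixes p :: "rat poly"
  obtains m P where "m > 0" "map_poly rat_of_int P = smult (of_int m) p"
proof -
  have "\<exists>m P. m > 0 \<and> map_poly rat_of_int P = smult (of_int m) p"
  proof (induction p)
    case 0
    have "map_poly rat_of_int 0 = smult (of_int 1) 0" by simp
    then show ?case by (intro exI[of _ 1] exI[of _ 0]) simp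
  next
    case (pCons c p)
    then obtain m P where mP: "m > 0" "map_poly rat_of_int P = smult (of_int m) p" by blast
    obtain u v where uv: "quotient_of c = (u, v)" by (cases "quotient_of c")
    then have v: "v > 0" and c: "c = of_int u / of_int v"
      by (simp_all add: quotient_of_denom_pos quotient_of_div)
    have "map_poly rat_of_int (pCons (m * u) (smult v P)) = smult (of_int (m * v)) (pCons c p)"
    proof (rule poly_eqI)
      fix i
      have *: "rat_of_int (coeff P j) = of_int m * coeff p j" for j
        using arg_cong[OF mP(2), of "\<lambda>p. coeff p j"] by (simp add: coeff_map_poly)
      show "coeff (map_poly rat_of_int (pCons (m * u) (smult v P))) i =
          coeff (smult (of_int (m * v)) (pCons c p)) i"
        using v by (cases i) (simp_all add: coeff_map_poly * c)
    qed
    with v mP(1) show ?case by (intro exI[of _ "m * v"] exI[of _ "pCons (m * u) (smult v P)"]) simp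
  qed
  then show ?thesis using that by blast
qed

text \<open>Gauss's lemma: after denominators are cleared, multiplicativity of
  \<open>primitive_part\<close> removes the common scale \<open>m * n\<close>, and the content of
  \<open>f\<close> is given back to one factor. Only the degrees of \<open>p\<close> and
  \<open>q\<close> are kept, which is all that irreducibility needs.\<close>

lemma int_poly_factorization_of_rat:
  fixes f :: "int poly" and p q :: "rat poly"
  assumes "map_poly rat_of_int f = p * q"
  obtains g h where "f = g * h" "degree g = degree p" "degree h = degree q"
proof (cases "f = 0")
  case True
  then have "p * q = 0" using assms by simp
  then consider "p = 0" | "q = 0" by auto
  then show ?thesis
  \<comment> \<open>The nonzero factor may have any degree, so a monomial of that degree stands in
    for it.\<close>
  proof cases
    case 1
    show ?thesis
      by (rule that[of 0 "monom 1 (degree q)"]) (simp_all add: True 1 degree_monom_eq)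
  next
    case 2
    show ?thesis
      by (rule that[of "monom 1 (degree p)" 0]) (simp_all add: True 2 degree_monom_eq)
  qed
next
  case False
  obtain m P where m: "m > 0" "map_poly rat_of_int P = smult (of_int m) p"
    by (rule rat_poly_clear_denominators)
  obtain n Q where n: "n > 0" "map_poly rat_of_int Q = smult (of_int n) q"
    by (rule rat_poly_clear_denominators)
  have "map_poly rat_of_int (P * Q) = map_poly rat_of_int (smult (m * n) f)"
    unfolding of_int_poly_mult m n
    by (rule poly_eqI) (simp add: coeff_map_poly assms[symmetric])
  then have PQ: "smult (m * n) f = P * Q"
    by (metis (no_types, lifting) coeff_map_poly of_int_0 of_int_eq_iff poly_eqI)
  \<comment> \<open>Scaling changes the primitive part only by the sign of the scalar, and
    \<open>m * n\<close> is positive.\<close>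
  have "primitive_part f = primitive_part (smult (m * n) f)"
    using m n by (simp add: primitive_part_smult unit_factor_mult)
  also have "\<dots> = primitive_part P * primitive_part Q"
    unfolding PQ by (rule primitive_part_mult)
  finally have "f = smult (content f) (primitive_part P) * primitive_part Q"
    using content_times_primitive_part[of f] by simp
  moreover have "degree P = degree p" "degree Q = degree q"
    using m n degree_of_int_poly[of P, where 'a = rat] degree_of_int_poly[of Q, where 'a = rat] by simp_all
  ultimately show ?thesis
    using False by (intro that[of "smult (content f) (primitive_part P)" "primitive_part Q"]) simp_all
qed

text \<open>Nonzero constants are units over the rationals, so integer factorizations with a
  constant factor, such as the content, may be ignored.\<close>

lemma irreducible_rat_polyI:
  fixes f :: "int poly"
  assumes "degree f > 0"
    and "\<And>g h. f = g * h \<Longrightarrow> degree g > 0 \<Longrightarrow> degree h > 0 \<Longrightarrow> False"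
  shows "irreducible (map_poly rat_of_int f)"
proof (rule irreducibleI)
  have deg: "degree (map_poly rat_of_int f) > 0"
    using assms(1) by (simp add: degree_of_int_poly)
  then show nz: "map_poly rat_of_int f \<noteq> 0" by auto
  show "\<not> map_poly rat_of_int f dvd 1"
    using deg by (auto simp: is_unit_iff_degree[OF nz])
  fix p q assume pq: "map_poly rat_of_int f = p * q"
  then have "p \<noteq> 0" "q \<noteq> 0" using nz by auto
  moreover obtain g h where "f = g * h" "degree g = degree p" "degree h = degree q"
    using int_poly_factorization_of_rat[OF pq] by blast
  ultimately show "p dvd 1 \<or> q dvd 1"
    using assms(2)[of g h] by (auto simp: is_unit_iff_degree)
qed

section \<open>Location of the roots and ratio of values\<close>

text \<open>Roots are split off one at a time, each contributing a factor above \<open>k\<close>;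
  the leading coefficient cancels in the ratio. The weak inequality is what the induction carries,
  since strictness fails for constants.\<close>

lemma poly_norm_ratio:
  fixes p :: "complex poly"
  assumes "k > 0" and "poly p a \<noteq> 0"
    and "\<And>z. poly p z = 0 \<Longrightarrow> k * cmod (z - a) < cmod (z - b)"
  shows "k ^ degree p * cmod (poly p a) \<le> cmod (poly p b) \<and>
    (degree p > 0 \<longrightarrow> k ^ degree p * cmod (poly p a) < cmod (poly p b))"
  using assms(2,3)
proof (induction "degree p" arbitrary: p)
  case 0
  then obtain c where "p = [:c:]" by (metis degree_eq_zeroE)
  then show ?case by simp
next
  case (Suc n)
  have "\<not> constant (poly p)" using Suc.hyps(2) by (simp add: constant_degree)
  then obtain z where z: "poly p z = 0" using fundamental_theorem_of_algebra by blast
  then obtain q where p: "p = [:- z, 1:] * q" by (auto simp: poly_eq_0_iff_dvd elim: dvdE)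
  have "q \<noteq> 0" using Suc.prems(1) p by auto
  then have deg: "degree p = Suc (degree q)" unfolding p by (subst degree_mult_eq) auto
  have qa: "poly q a \<noteq> 0" using Suc.prems(1) p by auto
  have IH: "k ^ degree q * cmod (poly q a) \<le> cmod (poly q b)"
    using Suc.hyps(1)[of q] Suc.hyps(2) deg qa Suc.prems(2) p by simp
  \<comment> \<open>Strictness comes from the root \<open>z\<close> alone and survives because the
    factor belonging to \<open>q\<close> is positive by \<open>qa\<close>.\<close>
  have "(k * cmod (z - a)) * (k ^ degree q * cmod (poly q a)) < cmod (z - b) * cmod (poly q b)"
    using Suc.prems(2)[OF z] IH qa \<open>k > 0\<close> by (intro mult_less_le_imp_less) auto
  then have "k ^ degree p * cmod (poly p a) < cmod (poly p b)"
    by (simp add: deg) (simp add: p norm_mult norm_minus_commute mult_ac flip: left_diff_distrib)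
  then show ?case by simp
qed

lemma int_poly_ratio_gt:
  fixes g :: "int poly"
  assumes "k > 0" "degree g > 0" "poly g a \<noteq> 0"
    and "\<And>z. poly (map_poly of_int g) z = 0 \<Longrightarrow>
      k * cmod (z - of_real (of_int a)) < cmod (z - of_real (of_int b))"
  shows "k ^ degree g < real_of_int \<bar>poly g b\<bar> / real_of_int \<bar>poly g a\<bar>"
proof -
  have "k ^ degree g * cmod (of_int (poly g a)) < cmod (of_int (poly g b))"
    using poly_norm_ratio[of k "map_poly of_int g" "of_int a" "of_int b"] assms
    by (simp add: poly_of_int_poly degree_of_int_poly)
  then show ?thesis
    using assms(3) by (simp add: pos_less_divide_eq)
qed

section \<open>Factors and unitary divisors\<close>

lemma abs_factor_in_unitary_divisors:
  fixes g h :: "int poly"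
  assumes "poly (g * h) x \<noteq> 0" "gcd (poly (g * h) x) (poly (pderiv (g * h)) x) = 1"
  shows "\<bar>poly g x\<bar> \<in> unitary_divisors (poly (g * h) x)"
proof -
  have "coprime (poly g x) (poly h x)"
  proof (rule coprimeI)
    fix c assume "c dvd poly g x" "c dvd poly h x"
    then have "c dvd gcd (poly (g * h) x) (poly (pderiv (g * h)) x)"
      by (auto simp: pderiv_mult)
    then show "c dvd 1" unfolding assms(2) .
  qed
  \<comment> \<open>The cofactor absorbs the sign of \<open>poly g x\<close>, which does not affect
    coprimality.\<close>
  moreover have "poly (g * h) x div \<bar>poly g x\<bar> = sgn (poly g x) * poly h x"
  proof -
    have "poly (g * h) x = \<bar>poly g x\<bar> * (sgn (poly g x) * poly h x)"
      by (simp add: mult.assoc[symmetric] abs_mult_sgn)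
    with assms(1) show ?thesis by (simp only:) simp
  qed
  ultimately show ?thesis
    using assms(1) unfolding unitary_divisors_def
    by (cases "poly g x" "0 :: int" rule: linorder_cases) auto
qed

lemma factor_ratio_le_q_u:
  fixes g h :: "int poly"
  assumes nz: "poly (g * h) a \<noteq> 0" "poly (g * h) b \<noteq> 0"
    and "gcd (poly (g * h) a) (poly (pderiv (g * h)) a) = 1"
    and "gcd (poly (g * h) b) (poly (pderiv (g * h)) b) = 1"
    and le: "real_of_int \<bar>poly g b\<bar> / real_of_int \<bar>poly g a\<bar>
      \<le> sqrt (real_of_int \<bar>poly (g * h) b\<bar> / real_of_int \<bar>poly (g * h) a\<bar>)"
  shows "real_of_int \<bar>poly g b\<bar> / real_of_int \<bar>poly g a\<bar> \<le> q\<^sub>u (g * h) a b"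
  unfolding q\<^sub>u_def
proof (rule Max_ge)
  show "finite (unitary_ratios (g * h) a b)"
    using nz by (rule unitary_ratios_finite)
  show "real_of_int \<bar>poly g b\<bar> / real_of_int \<bar>poly g a\<bar> \<in> unitary_ratios (g * h) a b"
    unfolding unitary_ratios_def
    using abs_factor_in_unitary_divisors[of g h a] abs_factor_in_unitary_divisors[of g h b] assms
    by blast
qed

lemma exists_factor_ratio_le_q_u:
  fixes f g h :: "int poly"
  assumes f: "f = g * h" and nz: "poly f a \<noteq> 0" "poly f b \<noteq> 0"
    and gcd: "gcd (poly f a) (poly (pderiv f) a) = 1" "gcd (poly f b) (poly (pderiv f) b) = 1"
  obtains p where "p = g \<or> p = h"
    "real_of_int \<bar>poly p b\<bar> / real_of_int \<bar>poly p a\<bar> \<le> q\<^sub>u f a b"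
proof -
  define r where "r p = real_of_int \<bar>poly p b\<bar> / real_of_int \<bar>poly p a\<bar>" for p
  have r: "r f = r g * r h" "r g \<ge> 0" "r h \<ge> 0"
    unfolding r_def f by (simp_all add: abs_mult)
  have "r g \<le> sqrt (r f) \<or> r h \<le> sqrt (r f)"
  proof (rule ccontr)
    assume "\<not> ?thesis"
    then have "sqrt (r f) * sqrt (r f) < r g * r h"
      using r by (intro mult_strict_mono') auto
    then show False using r by simp
  qed
  then show ?thesis
  proof
    assume "r g \<le> sqrt (r f)"
    then show ?thesis
      using factor_ratio_le_q_u[of g h a b] nz gcd that[of g] unfolding f r_def by blast
  next
    assume "r h \<le> sqrt (r f)"
    then show ?thesis
      using factor_ratio_le_q_u[of h g a b] nz gcd that[of h]
      unfolding f r_def mult.commute[of g h] by blast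
  qed
qed

section \<open>The irreducibility criterion and its three cases\<close>

text \<open>Common source of the three claims, with \<open>n\<close> a lower bound for the degrees
  of nonconstant factors. A proper factorization has a factor \<open>p\<close> whose ratio of values
  is at most \<open>q\<^sub>u f a b\<close>, hence at most \<open>k ^ n\<close>, but exceeds
  \<open>k ^ degree p\<close>.\<close>

lemma irreducible_if_roots_apart:
  fixes f :: "int poly"
  assumes "0 < \<bar>poly f a\<bar>" and "\<bar>poly f a\<bar> < \<bar>poly f b\<bar>"
    and gcd: "gcd (poly f a) (poly (pderiv f) a) = 1" "gcd (poly f b) (poly (pderiv f) b) = 1"
    and "k \<ge> 1" "q\<^sub>u f a b \<le> k ^ n"
    and roots: "\<And>z. poly (map_poly of_int f) z = 0 \<Longrightarrow>
      k * cmod (z - of_real (of_int a)) < cmod (z - of_real (of_int b))"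
    and factors: "\<And>g. g dvd f \<Longrightarrow> degree g > 0 \<Longrightarrow> n \<le> degree g"
  shows "irreducible (map_poly rat_of_int f)"
proof (rule irreducible_rat_polyI)
  have nz: "poly f a \<noteq> 0" "poly f b \<noteq> 0" using assms(1,2) by auto
  show "degree f > 0"
  proof (rule ccontr)
    assume "\<not> degree f > 0"
    then obtain c where "f = [:c:]" by (metis degree_eq_zeroE not_gr_zero)
    then show False using assms(2) by simp
  qed
  fix g h assume gh: "f = g * h" "degree g > 0" "degree h > 0"
  obtain p where p: "p = g \<or> p = h"
    "real_of_int \<bar>poly p b\<bar> / real_of_int \<bar>poly p a\<bar> \<le> q\<^sub>u f a b"
    using exists_factor_ratio_le_q_u[OF gh(1) nz gcd] by blast
  then have pf: "p dvd f" "degree p > 0" "poly p a \<noteq> 0" using gh nz by auto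
  then have "n \<le> degree p" using factors by blast
  have "k ^ degree p < real_of_int \<bar>poly p b\<bar> / real_of_int \<bar>poly p a\<bar>"
  proof (rule int_poly_ratio_gt)
    fix z :: complex assume "poly (map_poly of_int p) z = 0"
    then have "poly (map_poly of_int f) z = 0"
      using pf(1) by (auto simp: of_int_poly_mult elim!: dvdE)
    then show "k * cmod (z - of_real (of_int a)) < cmod (z - of_real (of_int b))" by (rule roots)
  qed (use pf \<open>k \<ge> 1\<close> in auto)
  moreover have "k ^ n \<le> k ^ degree p"
    using \<open>k \<ge> 1\<close> \<open>n \<le> degree p\<close> by (rule power_increasing[rotated])
  ultimately show False using p(2) assms(6) by linarith
qed

text \<open>Turns the absence of rational roots into the degree bound 2 for nonconstant
  factors.\<close>

lemma rat_root_of_linear_factor: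
  fixes f g :: "int poly"
  assumes "g dvd f" "degree g = 1"
  obtains r :: rat where "poly (map_poly of_int f) r = 0"
proof -
  obtain c d where g: "g = [:c, d:]" and "d \<noteq> 0"
    using assms(2) by (metis degree1_coeffs)
  have "poly (map_poly rat_of_int g) (- of_int c / of_int d) = 0"
    using \<open>d \<noteq> 0\<close> by (simp add: g map_poly_pCons)
  then show ?thesis
    using assms(1) by (intro that[of "- of_int c / of_int d"]) (auto simp: of_int_poly_mult elim!: dvdE)
qed

text \<open>The difference of the squared distances is linear in \<open>Re z\<close>, so the
  boundary is the perpendicular bisector, the limit of the Apollonius circles as the ratio tends to
  1. The product form covers both orders of \<open>a\<close> and \<open>b\<close>.\<close>

lemma cmod_diff_less_iff:
  "cmod (z - of_real a) < cmod (z - of_real b) \<longleftrightarrow> 0 < (a - b) * (Re z - (a + b) / 2)"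
proof -
  have "cmod (z - of_real a) < cmod (z - of_real b) \<longleftrightarrow>
      (cmod (z - of_real a))\<^sup>2 < (cmod (z - of_real b))\<^sup>2"
    by (simp add: power_mono_iff flip: not_le)
  also have "\<dots> \<longleftrightarrow> 0 < (a - b) * (Re z - (a + b) / 2)"
    unfolding cmod_power2 by (simp add: power2_eq_square field_simps)
  finally show ?thesis .
qed

theorem theorem3p1:
  fixes f :: "int poly" and a b :: int
  assumes "0 < \<bar>poly f a\<bar>" and "\<bar>poly f a\<bar> < \<bar>poly f b\<bar>"
    and "gcd (poly f a) (poly (pderiv f) a) = 1"
    and "gcd (poly f b) (poly (pderiv f) b) = 1"
  shows "(q\<^sub>u f a b > 1 \<and>
           (\<forall>z::complex. poly (map_poly of_int f) z = 0 \<longrightarrow>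
              z \<in> inside (apollonius_circle (of_int a) (of_int b) (q\<^sub>u f a b)))
           \<longrightarrow> irreducible (map_poly rat_of_int f)) \<and>
         (q\<^sub>u f a b > 1 \<and>
           (\<forall>z::complex. poly (map_poly of_int f) z = 0 \<longrightarrow>
              z \<in> inside (apollonius_circle (of_int a) (of_int b) (sqrt (q\<^sub>u f a b)))) \<and>
           (\<forall>r::rat. poly (map_poly of_int f) r \<noteq> 0)
           \<longrightarrow> irreducible (map_poly rat_of_int f)) \<and>
         (q\<^sub>u f a b = 1 \<and>
           (b > a \<and> (\<forall>z::complex. poly (map_poly of_int f) z = 0 \<longrightarrow>
                        Re z < (of_int a + of_int b) / 2) \<or>
            a > b \<and> (\<forall>z::complex. poly (map_poly of_int f) z = 0 \<longrightarrow>
                        Re z > (of_int a + of_int b) / 2))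
           \<longrightarrow> irreducible (map_poly rat_of_int f))"
proof (intro conjI impI; (elim conjE)?)
  let ?q = "q\<^sub>u f a b"
  note irreducible = irreducible_if_roots_apart[OF assms]
  {
    assume q: "?q > 1" and roots: "\<forall>z::complex. poly (map_poly of_int f) z = 0 \<longrightarrow>
      z \<in> inside (apollonius_circle (of_int a) (of_int b) ?q)"
    \<comment> \<open>With \<open>n = 1\<close> the degree bound is trivial.\<close>
    show "irreducible (map_poly rat_of_int f)"
      using q roots by (intro irreducible[of ?q 1]) (auto simp: inside_apollonius_circle_gt_1)
  next
    assume q: "?q > 1" and roots: "\<forall>z::complex. poly (map_poly of_int f) z = 0 \<longrightarrow>
      z \<in> inside (apollonius_circle (of_int a) (of_int b) (sqrt ?q))"
      and no_rat: "\<forall>r::rat. poly (map_poly of_int f) r \<noteq> 0"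
    \<comment> \<open>Here \<open>n = 2\<close> makes up for the smaller ratio, as the square of
      \<open>sqrt ?q\<close> is \<open>?q\<close>.\<close>
    show "irreducible (map_poly rat_of_int f)"
    proof (rule irreducible[of "sqrt ?q" 2])
      fix g assume "g dvd f" "degree g > 0"
      then have "degree g \<noteq> 1"
        using no_rat rat_root_of_linear_factor by blast
      with \<open>degree g > 0\<close> show "2 \<le> degree g" by linarith
    qed (use q roots in \<open>auto simp: inside_apollonius_circle_gt_1\<close>)
  next
    assume q: "?q = 1" and roots:
      "b > a \<and> (\<forall>z::complex. poly (map_poly of_int f) z = 0 \<longrightarrow>
                  Re z < (of_int a + of_int b) / 2) \<or>
       a > b \<and> (\<forall>z::complex. poly (map_poly of_int f) z = 0 \<longrightarrow>
                  Re z > (of_int a + of_int b) / 2)"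
    \<comment> \<open>For \<open>k = 1\<close> the half-plane of points closer to \<open>a\<close>
      than to \<open>b\<close> replaces the disk.\<close>
    have "cmod (z - of_real (of_int a)) < cmod (z - of_real (of_int b))"
      if "poly (map_poly of_int f) z = 0" for z
      unfolding cmod_diff_less_iff using roots that
      by (auto intro: mult_pos_pos mult_neg_neg)
    then show "irreducible (map_poly rat_of_int f)"
      using q by (intro irreducible[of 1 1]) auto
  }
qed

end
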